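(* Let $(A,\prec,\succ,\vee)$ be a $\mathcal C$-NS-algebra and let $\star$ denote the sum of the products $\prec$, $\succ$ and $\vee$ on $A$. Define $H:A\otimes A\to A$ by $H(a\otimes a'):=a\vee a'$ for all $a,a'\in A$. Then $H$ is a 2-cocycle on $(A,\star)$ with values in the $(A,\star)$-bimodule $(A,\succ,\prec)$, and $\mathrm{Id}_A:(A,\succ,\prec)\to(A,\star)$ is an $H$-twisted Rota-Baxter operator on $A$.
   Context: Fix a commutative ring $R$; all modules, tensor products and linear maps are over $R$. An algebra $(A,\mu_1,\dots,\mu_s)$ is an $R$-module $A$ with linear maps (products) $\mu_i:A\otimes A\to A$; no associativity or unit is assumed. For a single product write $ab=\mu(a\otimes b)$. Fix a collection of multilinear relations $\mathcal R_1=0,\dots,\mathcal R_k=0$ in one binary product: an $n$-linear relation is an $R$-linear combination of parenthesized (non-associative) monomials in $x_1,\dots,x_n$, each variable occurring exactly once in each monomial. $\mathcal C$ is the category of all algebras $(A,\mu)$ in which these relations hold for all substitutions of elements of $A$; $(A,\mu)\in\mathcal C$ means that $(A,\mu)$ satisfies all of them. Bimodule: let $(A,\mu)\in\mathcal C$ and let $M$ be an $R$-module with linear maps $l,r:A\to\mathrm{End}(M)$, written $a\cdot m:=l(a)(m)$ and $m\cdot a:=r(a)(m)$ (left and right actions). $(M,l,r)$, or simply $M$, is an $A$-bimodule if $A\oplus M$ with the product $(a,m)*(a',m'):=(aa',a\cdot m'+m\cdot a')$ belongs to $\mathcal C$. 2-cocycle on $A$ with values in an $A$-bimodule $M$: a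 linear map $H:A\otimes A\to M$ such that $A\oplus M$ with the product $(a,m)*_H(a',m'):=(aa',a\cdot m'+m\cdot a'+H(a\otimes a'))$ belongs to $\mathcal C$. $H$-twisted Rota-Baxter operator on $M$ (for $H$ a 2-cocycle on $A$ with values in $M$): a linear map $\mathrm T:M\to A$ with $\mathrm T(m)\mathrm T(m')=\mathrm T\big(\mathrm T(m)\cdot m'+m\cdot\mathrm T(m')+H(\mathrm T(m)\otimes\mathrm T(m'))\big)$ for all $m,m'\in M$. $\mathcal C$-NS-algebra: an algebra $(A,\prec,\succ,\vee)$ with three products such that $(A\oplus A,\boxtimes)\in\mathcal C$, where $(a,x)\boxtimes(a',x'):=(a\star a',\,a\succ x'+x\prec a')$ and $a\star a':=a\succ a'+a\prec a'+a\vee a'$. Equivalently, $(A,\star)\in\mathcal C$ and $(A,\succ,\prec)$ is an $(A,\star)$-bimodule, where $(A,\succ,\prec)$ denotes the $R$-module $A$ with left action $a\cdot x:=a\succ x$ and right action $x\cdot a:=x\prec a$. *)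

theory Defs
  imports "HOL-Algebra.Module"
begin

text \<open>Linear maps defined on a tensor product \<open>M \<otimes> N\<close> are represented, through the universal
  property, by the corresponding bilinear maps of two arguments. A linear map from \<open>A\<close> into
  \<open>End(M)\<close>, with its pointwise module structure, is likewise a bilinear map from \<open>A\<close> and \<open>M\<close> to \<open>M\<close>.\<close>

definition linear_map ::
  "('r, 'x) ring_scheme \<Rightarrow> ('r, 'm, 'y) module_scheme \<Rightarrow> ('r, 'n, 'z) module_scheme \<Rightarrow> ('m \<Rightarrow> 'n) \<Rightarrow> bool"
where
  "linear_map R M N f \<longleftrightarrow>
     f \<in> carrier M \<rightarrow> carrier N \<and>
     (\<forall>x\<in>carrier M. \<forall>y\<in>carrier M. f (x \<oplus>\<^bsub>M\<^esub> y) = f x \<oplus>\<^bsub>N\<^esub> f y) \<and>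
     (\<forall>c\<in>carrier R. \<forall>x\<in>carrier M. f (c \<odot>\<^bsub>M\<^esub> x) = c \<odot>\<^bsub>N\<^esub> f x)"

definition bilinear_map ::
  "('r, 'x) ring_scheme \<Rightarrow> ('r, 'm, 'y) module_scheme \<Rightarrow> ('r, 'n, 'z) module_scheme \<Rightarrow>
   ('r, 'p, 'w) module_scheme \<Rightarrow> ('m \<Rightarrow> 'n \<Rightarrow> 'p) \<Rightarrow> bool"
where
  "bilinear_map R M N P f \<longleftrightarrow>
     (\<forall>x\<in>carrier M. linear_map R N P (\<lambda>y. f x y)) \<and>
     (\<forall>y\<in>carrier N. linear_map R M P (\<lambda>x. f x y))"

text \<open>The ring fields of a module record play no role in the locale \<^locale>\<open>module\<close>; they are filled
  in componentwise.\<close>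

definition direct_sum ::
  "('r, 'm, 'x) module_scheme \<Rightarrow> ('r, 'n, 'y) module_scheme \<Rightarrow> ('r, 'm \<times> 'n) module"
where
  "direct_sum M N =
     \<lparr> carrier = carrier M \<times> carrier N,
       mult = (\<lambda>(x, y) (x', y'). (x \<otimes>\<^bsub>M\<^esub> x', y \<otimes>\<^bsub>N\<^esub> y')),
       one = (\<one>\<^bsub>M\<^esub>, \<one>\<^bsub>N\<^esub>),
       zero = (\<zero>\<^bsub>M\<^esub>, \<zero>\<^bsub>N\<^esub>),
       add = (\<lambda>(x, y) (x', y'). (x \<oplus>\<^bsub>M\<^esub> x', y \<oplus>\<^bsub>N\<^esub> y')),
       smult = (\<lambda>c (x, y). (c \<odot>\<^bsub>M\<^esub> x, c \<odot>\<^bsub>N\<^esub> y)) \<rparr>"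

datatype na_monomial = Var nat | Prod na_monomial na_monomial

primrec mon_vars :: "na_monomial \<Rightarrow> nat list" where
  "mon_vars (Var i) = [i]"
| "mon_vars (Prod s t) = mon_vars s @ mon_vars t"

text \<open>A formal linear combination of monomials is a list of pairs (coefficient, monomial).\<close>

type_synonym 'r relation_term = "('r \<times> na_monomial) list"

definition multilinear_relation :: "('r, 'x) ring_scheme \<Rightarrow> nat \<Rightarrow> 'r relation_term \<Rightarrow> bool" where
  "multilinear_relation R n \<rho> \<longleftrightarrow>
     (\<forall>(c, t)\<in>set \<rho>. c \<in> carrier R \<and> distinct (mon_vars t) \<and> set (mon_vars t) = {1..n})"

primrec eval_monomial :: "('a \<Rightarrow> 'a \<Rightarrow> 'a) \<Rightarrow> (nat \<Rightarrow> 'a) \<Rightarrow> na_monomial \<Rightarrow> 'a" where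
  "eval_monomial \<mu> x (Var i) = x i"
| "eval_monomial \<mu> x (Prod s t) = \<mu> (eval_monomial \<mu> x s) (eval_monomial \<mu> x t)"

definition eval_relation ::
  "('r, 'a, 'x) module_scheme \<Rightarrow> ('a \<Rightarrow> 'a \<Rightarrow> 'a) \<Rightarrow> (nat \<Rightarrow> 'a) \<Rightarrow> 'r relation_term \<Rightarrow> 'a"
where
  "eval_relation A \<mu> x \<rho> =
     foldr (\<lambda>(c, t) s. (c \<odot>\<^bsub>A\<^esub> eval_monomial \<mu> x t) \<oplus>\<^bsub>A\<^esub> s) \<rho> \<zero>\<^bsub>A\<^esub>"

text \<open>Membership of \<open>(A, \<mu>)\<close> in the category \<open>\<C>\<close> determined by the relations \<open>\<rho> = 0\<close>, for \<open>\<rho>\<close> in the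
  list \<open>\<R>\<close>. A substitution is given by a sequence of elements of \<open>A\<close>, of which only the entries
  occurring in the relation matter.\<close>

definition in_category ::
  "('r, 'x) ring_scheme \<Rightarrow> 'r relation_term list \<Rightarrow> ('r, 'a, 'y) module_scheme \<Rightarrow>
   ('a \<Rightarrow> 'a \<Rightarrow> 'a) \<Rightarrow> bool"
where
  "in_category R \<R> A \<mu> \<longleftrightarrow>
     module R A \<and> bilinear_map R A A A \<mu> \<and>
     (\<forall>\<rho>\<in>set \<R>. \<forall>x. (\<forall>i. x i \<in> carrier A) \<longrightarrow> eval_relation A \<mu> x \<rho> = \<zero>\<^bsub>A\<^esub>)"

text \<open>In the following, \<open>l a m\<close> is the left action \<open>a \<cdot> m\<close> and \<open>r a m\<close> is the right action \<open>m \<cdot> a\<close>.\<close>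

definition semidirect_product ::
  "('a \<Rightarrow> 'a \<Rightarrow> 'a) \<Rightarrow> ('r, 'm, 'y) module_scheme \<Rightarrow> ('a \<Rightarrow> 'm \<Rightarrow> 'm) \<Rightarrow> ('a \<Rightarrow> 'm \<Rightarrow> 'm) \<Rightarrow>
   'a \<times> 'm \<Rightarrow> 'a \<times> 'm \<Rightarrow> 'a \<times> 'm"
where
  "semidirect_product \<mu> M l r = (\<lambda>(a, m) (a', m'). (\<mu> a a', l a m' \<oplus>\<^bsub>M\<^esub> r a' m))"

definition bimodule ::
  "('r, 'x) ring_scheme \<Rightarrow> 'r relation_term list \<Rightarrow> ('r, 'a, 'y) module_scheme \<Rightarrow> ('a \<Rightarrow> 'a \<Rightarrow> 'a) \<Rightarrow>
   ('r, 'm, 'z) module_scheme \<Rightarrow> ('a \<Rightarrow> 'm \<Rightarrow> 'm) \<Rightarrow> ('a \<Rightarrow> 'm \<Rightarrow> 'm) \<Rightarrow> bool"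
where
  "bimodule R \<R> A \<mu> M l r \<longleftrightarrow>
     in_category R \<R> A \<mu> \<and> module R M \<and> bilinear_map R A M M l \<and> bilinear_map R A M M r \<and>
     in_category R \<R> (direct_sum A M) (semidirect_product \<mu> M l r)"

definition twisted_semidirect_product ::
  "('a \<Rightarrow> 'a \<Rightarrow> 'a) \<Rightarrow> ('r, 'm, 'y) module_scheme \<Rightarrow> ('a \<Rightarrow> 'm \<Rightarrow> 'm) \<Rightarrow> ('a \<Rightarrow> 'm \<Rightarrow> 'm) \<Rightarrow>
   ('a \<Rightarrow> 'a \<Rightarrow> 'm) \<Rightarrow> 'a \<times> 'm \<Rightarrow> 'a \<times> 'm \<Rightarrow> 'a \<times> 'm"
where
  "twisted_semidirect_product \<mu> M l r H =
     (\<lambda>(a, m) (a', m'). (\<mu> a a', l a m' \<oplus>\<^bsub>M\<^esub> r a' m \<oplus>\<^bsub>M\<^esub> H a a'))"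

definition two_cocycle ::
  "('r, 'x) ring_scheme \<Rightarrow> 'r relation_term list \<Rightarrow> ('r, 'a, 'y) module_scheme \<Rightarrow> ('a \<Rightarrow> 'a \<Rightarrow> 'a) \<Rightarrow>
   ('r, 'm, 'z) module_scheme \<Rightarrow> ('a \<Rightarrow> 'm \<Rightarrow> 'm) \<Rightarrow> ('a \<Rightarrow> 'm \<Rightarrow> 'm) \<Rightarrow> ('a \<Rightarrow> 'a \<Rightarrow> 'm) \<Rightarrow> bool"
where
  "two_cocycle R \<R> A \<mu> M l r H \<longleftrightarrow>
     bimodule R \<R> A \<mu> M l r \<and> bilinear_map R A A M H \<and>
     in_category R \<R> (direct_sum A M) (twisted_semidirect_product \<mu> M l r H)"

definition twisted_rota_baxter ::
  "('r, 'x) ring_scheme \<Rightarrow> 'r relation_term list \<Rightarrow> ('r, 'a, 'y) module_scheme \<Rightarrow> ('a \<Rightarrow> 'a \<Rightarrow> 'a) \<Rightarrow>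
   ('r, 'm, 'z) module_scheme \<Rightarrow> ('a \<Rightarrow> 'm \<Rightarrow> 'm) \<Rightarrow> ('a \<Rightarrow> 'm \<Rightarrow> 'm) \<Rightarrow> ('a \<Rightarrow> 'a \<Rightarrow> 'm) \<Rightarrow>
   ('m \<Rightarrow> 'a) \<Rightarrow> bool"
where
  "twisted_rota_baxter R \<R> A \<mu> M l r H T \<longleftrightarrow>
     two_cocycle R \<R> A \<mu> M l r H \<and> linear_map R M A T \<and>
     (\<forall>m\<in>carrier M. \<forall>m'\<in>carrier M.
        \<mu> (T m) (T m') = T (l (T m) m' \<oplus>\<^bsub>M\<^esub> r (T m') m \<oplus>\<^bsub>M\<^esub> H (T m) (T m')))"

definition ns_star ::
  "('r, 'a, 'y) module_scheme \<Rightarrow> ('a \<Rightarrow> 'a \<Rightarrow> 'a) \<Rightarrow> ('a \<Rightarrow> 'a \<Rightarrow> 'a) \<Rightarrow> ('a \<Rightarrow> 'a \<Rightarrow> 'a) \<Rightarrow>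
   'a \<Rightarrow> 'a \<Rightarrow> 'a"
where
  "ns_star A lt gt vee a a' = gt a a' \<oplus>\<^bsub>A\<^esub> lt a a' \<oplus>\<^bsub>A\<^esub> vee a a'"

text \<open>The products \<open>\<prec>\<close>, \<open>\<succ>\<close>, \<open>\<or>\<close> are named \<open>lt\<close>, \<open>gt\<close>, \<open>vee\<close>.\<close>

definition ns_algebra ::
  "('r, 'x) ring_scheme \<Rightarrow> 'r relation_term list \<Rightarrow> ('r, 'a, 'y) module_scheme \<Rightarrow>
   ('a \<Rightarrow> 'a \<Rightarrow> 'a) \<Rightarrow> ('a \<Rightarrow> 'a \<Rightarrow> 'a) \<Rightarrow> ('a \<Rightarrow> 'a \<Rightarrow> 'a) \<Rightarrow> bool"
where
  "ns_algebra R \<R> A lt gt vee \<longleftrightarrow>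
     module R A \<and> bilinear_map R A A A lt \<and> bilinear_map R A A A gt \<and> bilinear_map R A A A vee \<and>
     in_category R \<R> (direct_sum A A)
       (\<lambda>(a, x) (a', x'). (ns_star A lt gt vee a a', gt a x' \<oplus>\<^bsub>A\<^esub> lt x a'))"

end

theory Submission
  imports Defs
begin

text \<open>The map \<open>(a, m) \<mapsto> (a, a + m)\<close> is an isomorphism from the semidirect product of
  \<open>(A, \<star>)\<close> and \<open>(A, \<succ>, \<prec>)\<close> onto the extension twisted by \<open>\<or>\<close>, so the latter inherits all
  relations of the former.\<close>

lemma linear_mapD:
  assumes "linear_map R M N f"
  shows "x \<in> carrier M \<Longrightarrow> f x \<in> carrier N"
    and "x \<in> carrier M \<Longrightarrow> y \<in> carrier M \<Longrightarrow> f (x \<oplus>\<^bsub>M\<^esub> y) = f x \<oplus>\<^bsub>N\<^esub> f y"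
    and "c \<in> carrier R \<Longrightarrow> x \<in> carrier M \<Longrightarrow> f (c \<odot>\<^bsub>M\<^esub> x) = c \<odot>\<^bsub>N\<^esub> f x"
  using assms by (auto simp: linear_map_def)

lemma linear_map_zero:
  assumes "module R M" "module R N" "linear_map R M N f"
  shows "f \<zero>\<^bsub>M\<^esub> = \<zero>\<^bsub>N\<^esub>"
proof -
  interpret M: module R M by fact
  interpret N: module R N by fact
  have "f \<zero>\<^bsub>M\<^esub> = f (\<zero>\<^bsub>R\<^esub> \<odot>\<^bsub>M\<^esub> \<zero>\<^bsub>M\<^esub>)" by simp
  also have "\<dots> = \<zero>\<^bsub>R\<^esub> \<odot>\<^bsub>N\<^esub> f \<zero>\<^bsub>M\<^esub>" by (rule linear_mapD[OF assms(3)]) auto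
  also have "\<dots> = \<zero>\<^bsub>N\<^esub>" using linear_mapD(1)[OF assms(3)] by simp
  finally show ?thesis .
qed

lemma bilinear_map_closed:
  assumes "bilinear_map R M N P f" "x \<in> carrier M" "y \<in> carrier N"
  shows "f x y \<in> carrier P"
  using assms by (auto simp: bilinear_map_def dest: linear_mapD(1))

lemma bilinear_mapD:
  assumes "bilinear_map R M N P f"
  shows "x \<in> carrier M \<Longrightarrow> linear_map R N P (\<lambda>y. f x y)"
    and "y \<in> carrier N \<Longrightarrow> linear_map R M P (\<lambda>x. f x y)"
  using assms by (auto simp: bilinear_map_def)

lemma bilinear_map_flip:
  "bilinear_map R M N P f \<Longrightarrow> bilinear_map R N M P (\<lambda>y x. f x y)"
  by (auto simp: bilinear_map_def)

text \<open>\<open>H\<close> is tied to \<open>vee\<close> only on the carrier, so bilinearity has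
  to be transferred between functions that may differ elsewhere. The module assumptions keep sums
  and scalar multiples of arguments inside the carriers, where \<open>eq\<close> applies.\<close>

lemma bilinear_map_cong:
  assumes "bilinear_map R A B P f" "module R A" "module R B"
    and eq: "\<And>x y. x \<in> carrier A \<Longrightarrow> y \<in> carrier B \<Longrightarrow> g x y = f x y"
  shows "bilinear_map R A B P g"
proof -
  interpret A: module R A by fact
  interpret B: module R B by fact
  show ?thesis
    using assms(1) by (auto simp: bilinear_map_def linear_map_def Pi_def eq)
qed

lemma module_direct_sum:
  assumes "module R M" "module R N"
  shows "module R (direct_sum M N)"
proof -
  interpret M: module R M by fact
  interpret N: module R N by fact
  let ?D = "direct_sum M N"
  have "\<exists>q\<in>carrier ?D. q \<oplus>\<^bsub>?D\<^esub> p = \<zero>\<^bsub>?D\<^esub>" if "p \<in> carrier ?D" for p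
    using that
    by (intro bexI[of _ "(\<ominus>\<^bsub>M\<^esub> fst p, \<ominus>\<^bsub>N\<^esub> snd p)"]) (auto simp: direct_sum_def M.l_neg N.l_neg)
  then have "abelian_group ?D"
    by (intro abelian_groupI) (auto simp: direct_sum_def M.a_ac N.a_ac)
  then show ?thesis
    by (intro moduleI M.is_cring)
      (auto simp: direct_sum_def M.smult_l_distr N.smult_l_distr M.smult_r_distr N.smult_r_distr
        M.smult_assoc1 N.smult_assoc1)
qed

lemma eval_monomial_closed:
  assumes "bilinear_map R A A A \<mu>" "\<And>i. x i \<in> carrier A"
  shows "eval_monomial \<mu> x t \<in> carrier A"
  by (induction t) (auto intro: bilinear_map_closed assms)

lemma eval_relation_closed:
  assumes "module R A" "bilinear_map R A A A \<mu>" "\<And>i. x i \<in> carrier A"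
    and "\<forall>(c, t)\<in>set \<rho>. c \<in> carrier R"
  shows "eval_relation A \<mu> x \<rho> \<in> carrier A"
proof -
  interpret module R A by fact
  show ?thesis
    using assms(4)
    by (induction \<rho>) (auto simp: eval_relation_def eval_monomial_closed[OF assms(2,3)])
qed

lemma eval_monomial_hom:
  assumes "bilinear_map R A A A \<mu>" "\<And>i. x i \<in> carrier A"
    and "\<And>a b. a \<in> carrier A \<Longrightarrow> b \<in> carrier A \<Longrightarrow> f (\<mu> a b) = \<nu> (f a) (f b)"
  shows "f (eval_monomial \<mu> x t) = eval_monomial \<nu> (\<lambda>i. f (x i)) t"
  by (induction t) (auto simp: assms(3) eval_monomial_closed[OF assms(1,2)])

text \<open>Multiplicativity of \<open>f\<close> passes through each monomial, and linearity of
  \<open>f\<close> through the linear combination. About \<open>\<nu>\<close> only its compatibility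
  with \<open>\<mu>\<close> is assumed, so the lemma also serves for products whose bilinearity has
  not been established separately. The closure facts enter because \<open>f\<close> is additive and
  multiplicative only on the carrier.\<close>

lemma eval_relation_hom:
  assumes "module R A" "module R B" "linear_map R A B f" "bilinear_map R A A A \<mu>"
    and "\<And>i. x i \<in> carrier A"
    and "\<And>a b. a \<in> carrier A \<Longrightarrow> b \<in> carrier A \<Longrightarrow> f (\<mu> a b) = \<nu> (f a) (f b)"
    and "\<forall>(c, t)\<in>set \<rho>. c \<in> carrier R"
  shows "f (eval_relation A \<mu> x \<rho>) = eval_relation B \<nu> (\<lambda>i. f (x i)) \<rho>"
proof -
  interpret module R A by fact
  note mon = eval_monomial_closed[OF assms(4,5)]
  show ?thesis
    using assms(7)
  proof (induction \<rho>)
    case Nil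
    then show ?case
      using linear_map_zero[OF assms(1-3)] by (simp add: eval_relation_def)
  next
    case (Cons p \<rho>)
    obtain c t where p: "p = (c, t)" by fastforce
    have c: "c \<in> carrier R" and \<rho>: "\<forall>(c, t)\<in>set \<rho>. c \<in> carrier R"
      using Cons.prems p by auto
    have "f (eval_relation A \<mu> x (p # \<rho>)) =
        f (c \<odot>\<^bsub>A\<^esub> eval_monomial \<mu> x t \<oplus>\<^bsub>A\<^esub> eval_relation A \<mu> x \<rho>)"
      by (simp add: eval_relation_def p)
    also have "\<dots> = c \<odot>\<^bsub>B\<^esub> f (eval_monomial \<mu> x t) \<oplus>\<^bsub>B\<^esub> f (eval_relation A \<mu> x \<rho>)"
      using c mon eval_relation_closed[OF assms(1,4,5) \<rho>] by (simp add: linear_mapD[OF assms(3)])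
    also have "\<dots> = eval_relation B \<nu> (\<lambda>i. f (x i)) (p # \<rho>)"
      by (simp add: Cons.IH[OF \<rho>] eval_monomial_hom[of R A \<mu> x f \<nu>, OF assms(4-6)] p)
        (simp add: eval_relation_def)
    finally show ?case .
  qed
qed

text \<open>Every argument of \<open>\<nu>\<close> is some \<open>f a\<close>, so each identity to
  be checked in \<open>B\<close> is the image of the corresponding identity for \<open>\<mu>\<close>
  in \<open>A\<close>.\<close>

lemma bilinear_map_surj_image:
  assumes "module R A" "linear_map R A B f" "f ` carrier A = carrier B"
    and "bilinear_map R A A A \<mu>"
    and hom: "\<And>a b. a \<in> carrier A \<Longrightarrow> b \<in> carrier A \<Longrightarrow> f (\<mu> a b) = \<nu> (f a) (f b)"
  shows "bilinear_map R B B B \<nu>"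
proof -
  interpret module R A by fact
  note f = linear_mapD[OF assms(2)]
  note cl = bilinear_map_closed[OF assms(4)]
  have "linear_map R B B (\<nu> (f a))" and "linear_map R B B (\<lambda>y. \<nu> y (f a))" if a: "a \<in> carrier A" for a
    \<comment> \<open>The reversed rewrite rules collect each side into a single application of
      \<open>f\<close>, after which bilinearity of \<open>\<mu>\<close> closes the goal.\<close>
    using a linear_mapD[OF bilinear_mapD(1)[OF assms(4) a]] linear_mapD[OF bilinear_mapD(2)[OF assms(4) a]]
    by (auto simp: linear_map_def assms(3)[symmetric] f cl
        simp flip: f(2,3) hom)
  then show ?thesis
    by (auto simp: bilinear_map_def assms(3)[symmetric])
qed

text \<open>A substitution in \<open>B\<close> lifts along \<open>f\<close> to one in
  \<open>A\<close>, where the relation evaluates to zero, and \<open>f\<close> carries this zero to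
  the value in \<open>B\<close>. Surjectivity is the right generality: the lemma is applied to the
  projection \<open>fst\<close> as well as to a bijective shear.\<close>

lemma in_category_surj_image:
  assumes "in_category R \<R> A \<mu>" "module R B" "linear_map R A B f" "f ` carrier A = carrier B"
    and hom: "\<And>a b. a \<in> carrier A \<Longrightarrow> b \<in> carrier A \<Longrightarrow> f (\<mu> a b) = \<nu> (f a) (f b)"
    and coeff: "\<forall>\<rho>\<in>set \<R>. \<forall>(c, t)\<in>set \<rho>. c \<in> carrier R"
  shows "in_category R \<R> B \<nu>"
proof -
  have A: "module R A" and \<mu>: "bilinear_map R A A A \<mu>"
    using assms(1) by (auto simp: in_category_def)
  have "eval_relation B \<nu> y \<rho> = \<zero>\<^bsub>B\<^esub>" if \<rho>: "\<rho> \<in> set \<R>" and y: "\<forall>i. y i \<in> carrier B" for \<rho> y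
  proof -
    \<comment> \<open>A substitution is a total sequence, so preimages are chosen for all indices at
      once.\<close>
    have "\<forall>i. \<exists>a. a \<in> carrier A \<and> f a = y i"
      using y assms(4) by (metis imageE)
    then obtain x where x: "\<And>i. x i \<in> carrier A" "\<And>i. f (x i) = y i"
      by metis
    have "eval_relation B \<nu> y \<rho> = f (eval_relation A \<mu> x \<rho>)"
      using eval_relation_hom[of R A B f \<mu> x \<nu>, OF A assms(2,3) \<mu> x(1) hom] coeff \<rho> x(2) by auto
    also have "\<dots> = f \<zero>\<^bsub>A\<^esub>"
      using assms(1) \<rho> x(1) by (simp add: in_category_def)
    finally show ?thesis
      using linear_map_zero[OF A assms(2,3)] by simp
  qed
  then show ?thesis
    using bilinear_map_surj_image[of R A B f \<mu> \<nu>, OF A assms(3,4) \<mu> hom] assms(2)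
    by (auto simp: in_category_def)
qed

theorem proposition6p5:
  fixes R :: "('r, 'x) ring_scheme"
    and A :: "('r, 'a, 'y) module_scheme"
    and \<R> :: "('r \<times> na_monomial) list list"
    and lt gt vee H :: "'a \<Rightarrow> 'a \<Rightarrow> 'a"
  assumes "cring R"
    and "\<forall>\<rho>\<in>set \<R>. \<exists>n. multilinear_relation R n \<rho>"
    and "ns_algebra R \<R> A lt gt vee"
    and "\<And>a a'. a \<in> carrier A \<Longrightarrow> a' \<in> carrier A \<Longrightarrow> H a a' = vee a a'"
  shows "two_cocycle R \<R> A (ns_star A lt gt vee) A (\<lambda>a x. gt a x) (\<lambda>a x. lt x a) H \<and>
         twisted_rota_baxter R \<R> A (ns_star A lt gt vee) A (\<lambda>a x. gt a x) (\<lambda>a x. lt x a) H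
           id"
proof -
  let ?s = "ns_star A lt gt vee" and ?r = "\<lambda>a x. lt x a"
  let ?D = "direct_sum A A" and ?f = "\<lambda>(a, m). (a, a \<oplus>\<^bsub>A\<^esub> m)"
  have A: "module R A" and lt: "bilinear_map R A A A lt" and gt: "bilinear_map R A A A gt"
    and vee: "bilinear_map R A A A vee"
    \<comment> \<open>The product in \<open>ns_algebra\<close> is already this semidirect product:
      the right action of \<open>a\<close> on \<open>x\<close> is \<open>lt x a\<close>, which
      explains the swap in \<open>?r\<close>.\<close>
    and semi: "in_category R \<R> ?D (semidirect_product ?s A gt ?r)"
    using assms(3) by (auto simp: ns_algebra_def semidirect_product_def)
  interpret module R A by (fact A)
  note cl = bilinear_map_closed[OF lt] bilinear_map_closed[OF gt] bilinear_map_closed[OF vee]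
  have coeff: "\<forall>\<rho>\<in>set \<R>. \<forall>(c, t)\<in>set \<rho>. c \<in> carrier R"
    using assms(2) by (fastforce simp: multilinear_relation_def)
  \<comment> \<open>The first component of the semidirect product is \<star> itself, so
    \<open>fst\<close> is a surjective homomorphism onto (A, \<star>). This also yields bilinearity
    of \<star>.\<close>
  have "in_category R \<R> A ?s"
  proof (rule in_category_surj_image[OF semi A _ _ _ coeff])
    show "linear_map R ?D A fst"
      by (auto simp: linear_map_def direct_sum_def)
    show "fst ` carrier ?D = carrier A"
      by (force simp: direct_sum_def)
  qed (auto simp: semidirect_product_def)
  then have bim: "bimodule R \<R> A ?s A gt ?r"
    using semi A gt bilinear_map_flip[OF lt] by (simp add: bimodule_def)
  have "in_category R \<R> ?D (twisted_semidirect_product ?s A gt ?r H)"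
  proof (rule in_category_surj_image[OF semi module_direct_sum[OF A A] _ _ _ coeff])
    show "linear_map R ?D ?D ?f"
      by (auto simp: linear_map_def direct_sum_def smult_r_distr a_ac)
    \<comment> \<open>The witness is the value at (a, m) of the inverse shear, which subtracts the
      first component from the second.\<close>
    have "(a, m) \<in> ?f ` (carrier A \<times> carrier A)" if "a \<in> carrier A" "m \<in> carrier A" for a m
      using that by (intro image_eqI[of _ _ "(a, \<ominus>\<^bsub>A\<^esub> a \<oplus>\<^bsub>A\<^esub> m)"])
        (auto simp: r_neg simp flip: a_assoc)
    then show "?f ` carrier ?D = carrier ?D"
      by (auto simp: direct_sum_def)
    \<comment> \<open>For p = (a, m) and q = (a', m'), the added term a \<star> a' contributes
      \<open>gt a a'\<close>, \<open>lt a a'\<close> and \<open>vee a a'\<close>. The first two turn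
      \<open>gt a m'\<close> and \<open>lt m a'\<close> into the actions on the sheared elements a'
      + m' and a + m; the third is the value of \<open>H\<close>.\<close>
    show "?f (semidirect_product ?s A gt ?r p q) =
        twisted_semidirect_product ?s A gt ?r H (?f p) (?f q)"
      if "p \<in> carrier ?D" "q \<in> carrier ?D" for p q
      using that linear_mapD(2)[OF bilinear_mapD(1)[OF gt]] linear_mapD(2)[OF bilinear_mapD(2)[OF lt]]
      by (auto simp: direct_sum_def semidirect_product_def twisted_semidirect_product_def
          ns_star_def assms(4) cl a_ac)
  qed
  then have coc: "two_cocycle R \<R> A ?s A gt ?r H"
    using bim bilinear_map_cong[OF vee A A assms(4)] by (simp add: two_cocycle_def)
  moreover have "linear_map R A A id"
    by (simp add: linear_map_def)
  \<comment> \<open>For the identity map, the twisted Rota-Baxter equation is the definition of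
    \<star> as a sum of three products, with \<open>H\<close> in place of
    \<open>vee\<close>.\<close>
  ultimately show ?thesis
    by (simp add: twisted_rota_baxter_def ns_star_def assms(4))
qed

end
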